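(* Let $X$ be a Lévy process in $\mathbb{R}^d$, $d\in\mathbb{N}$, and let $q:\mathbb{R}^d\to\mathbb{R}$ be a Borel function. Then $$\lim_{t\to 0^+}\Big[\sup_{x\in\mathbb{R}^d}\mathbb{E}^x\Big(\int_0^t|q(X_u)|\,du\Big)\Big]=0$$ if and only if $$\lim_{r\to 0^+}\Big[\sup_{x\in\mathbb{R}^d}\mathbb{E}^x\Big(\int_0^r\mathbf 1_{B(x,r)}(X_u)\,|q(X_u)|\,du\Big)\Big]=0 .$$
   Context: $\mathbb{P}^x,\mathbb{E}^x$ denote the law and expectation of the Lévy process started at $x$, i.e. $\mathbb{E}^xF(X)=\mathbb{E}^0F(X+x)$. $B(x,r)$ is the open Euclidean ball. *)

theory Defs
  imports "HOL-Probability.Probability"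
begin

definition cadlag :: "(real \<Rightarrow> 'v::topological_space) \<Rightarrow> bool" where
  "cadlag w \<longleftrightarrow> (\<forall>t\<ge>0. (w \<longlongrightarrow> w t) (at_right t)) \<and> (\<forall>t>0. \<exists>l. (w \<longlongrightarrow> l) (at_left t))"

(* Time is the half-line {0..}; the values X t for t < 0 are unconstrained and never used.
   M carries the law for which the process starts at 0. *)
locale levy_process = prob_space M for M :: "'a measure" +
  fixes X :: "real \<Rightarrow> 'a \<Rightarrow> 'v::euclidean_space"
  assumes rv: "\<And>t. 0 \<le> t \<Longrightarrow> random_variable borel (X t)"
    and start: "AE \<omega> in M. X 0 \<omega> = 0"
    and indep_increments:
      "\<And>n t. 0 \<le> t 0 \<Longrightarrow> strict_mono_on {..n} t \<Longrightarrow>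
         indep_vars (\<lambda>_. borel) (\<lambda>i \<omega>. X (t (Suc i)) \<omega> - X (t i) \<omega>) {..<n::nat}"
    and stationary_increments:
      "\<And>s h. 0 \<le> s \<Longrightarrow> 0 \<le> h \<Longrightarrow>
         distr M borel (\<lambda>\<omega>. X (s + h) \<omega> - X s \<omega>) = distr M borel (X h)"
    and stochastically_continuous:
      "\<And>t \<epsilon>. 0 \<le> t \<Longrightarrow> 0 < \<epsilon> \<Longrightarrow>
         ((\<lambda>s. prob {\<omega> \<in> space M. \<epsilon> < dist (X s \<omega>) (X t \<omega>)}) \<longlongrightarrow> 0) (at t within {0..})"
    and cadlag_paths: "AE \<omega> in M. cadlag (\<lambda>t. X t \<omega>)"

(* Expectation of a nonnegative path functional F for the process started at x. *)
definition expectation_from ::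
  "'a measure \<Rightarrow> (real \<Rightarrow> 'a \<Rightarrow> 'v::euclidean_space) \<Rightarrow> 'v \<Rightarrow> ((real \<Rightarrow> 'v) \<Rightarrow> ennreal) \<Rightarrow> ennreal"
  where "expectation_from M X x F = (\<integral>\<^sup>+\<omega>. F (\<lambda>u. X u \<omega> + x) \<partial>M)"

end

(* Let f(T) and K(r) be the two suprema. A path that has not left the ball of radius r around its
   starting point contributes at most K(r) to f(T) for T \<le> r, and after leaving it the process starts
   afresh, so f(T) \<le> K(r) + P(exit before T) f(T). As the paths are right-continuous at 0, the exit
   probability is at most 1/2 for small T, whence f(T) \<le> 2 K(r).
   The strong Markov property is avoided by watching the exit only along a finite grid of times, where
   independence of the increments suffices; for bounded q the error made between grid points vanishes
   with the mesh by stochastic continuity. A general q is reached by truncation. *)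

theory Submission imports Defs begin

lemma nn_integral_add_sum_add:
  assumes "f \<in> borel_measurable M" "\<And>j. j \<in> J \<Longrightarrow> g j \<in> borel_measurable M" "h \<in> borel_measurable M"
  shows "(\<integral>\<^sup>+x. f x + (\<Sum>j\<in>J. g j x) + h x \<partial>M)
    = (\<integral>\<^sup>+x. f x \<partial>M) + (\<Sum>j\<in>J. \<integral>\<^sup>+x. g j x \<partial>M) + (\<integral>\<^sup>+x. h x \<partial>M)"
  using assms by (simp add: nn_integral_add nn_integral_sum)

context levy_process
begin

section \<open>Transition operators, measurability and the exchange of expectation and time
  integral\<close>

definition transition :: "real \<Rightarrow> ('v \<Rightarrow> ennreal) \<Rightarrow> 'v \<Rightarrow> ennreal" where
  "transition u Q z = (\<integral>\<^sup>+\<omega>. Q (X u \<omega> + z) \<partial>M)"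

text \<open>Paths are cadlag only almost surely and arbitrary at negative times, so \<open>X\<close>
  itself need not be jointly measurable. Setting the process to 0 on a null set and clamping time at
  0 makes every path right-continuous, hence a pointwise limit of processes that are piecewise
  constant in time. This is what makes Fubini available below.\<close>

lemma ex_jointly_measurable_version:
  obtains Y where "(\<lambda>(u, \<omega>). Y u \<omega>) \<in> borel_measurable (borel \<Otimes>\<^sub>M M)"
    and "AE \<omega> in M. \<forall>u\<ge>0. Y u \<omega> = X u \<omega>"
proof -
  obtain N where N: "{\<omega> \<in> space M. \<not> cadlag (\<lambda>t. X t \<omega>)} \<subseteq> N" "N \<in> null_sets M"
    using cadlag_paths by (auto simp: eventually_ae_filter)
  define Y where "Y u \<omega> = (if \<omega> \<in> N then 0 else X (max 0 u) \<omega>)" for u \<omega>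
  have [measurable]: "N \<in> sets M" using N by auto
  have Ym [measurable]: "Y u \<in> borel_measurable M" for u
    unfolding Y_def using rv[of "max 0 u"] by measurable
  \<comment> \<open>The \<open>+ 1\<close> after the floor gives the first multiple of
    \<open>1 / real (Suc n)\<close> strictly above \<open>max 0 u\<close>, so the limit is
    approached from the right, where the paths are continuous.\<close>
  define s where "s n u = real (nat \<lfloor>real (Suc n) * max 0 u\<rfloor> + 1) / real (Suc n)" for n u
  have s_gt: "max 0 u < s n u" and s_le: "s n u \<le> max 0 u + 1 / real (Suc n)" for n u
  proof -
    have nat_floor: "y < real (nat \<lfloor>y\<rfloor> + 1)" "real (nat \<lfloor>y\<rfloor> + 1) \<le> y + 1" if "0 \<le> y" for y :: real
      using that by linarith+
    have frac: "y < m / N" "m / N \<le> y + 1 / N" if "N * y < m" "m \<le> N * y + 1" "0 < N" for y m N :: real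
      using that by (simp_all add: field_simps)
    have nonneg: "0 \<le> real (Suc n) * max 0 u" by simp
    show "max 0 u < s n u"
      unfolding s_def by (rule frac(1)[OF nat_floor[OF nonneg]]) simp
    show "s n u \<le> max 0 u + 1 / real (Suc n)"
      unfolding s_def by (rule frac(2)[OF nat_floor[OF nonneg]]) simp
  qed
  have s_lim: "filterlim (\<lambda>n. s n u) (at_right (max 0 u)) sequentially" for u
  proof -
    have "(\<lambda>n. max 0 u + 1 / real (Suc n)) \<longlonglongrightarrow> max 0 u + 0"
      by (intro tendsto_add tendsto_const LIMSEQ_Suc[OF lim_1_over_n])
    then have upper: "(\<lambda>n. max 0 u + 1 / real (Suc n)) \<longlonglongrightarrow> max 0 u"
      by (simp only: add_0_right)
    have "(\<lambda>n. s n u) \<longlonglongrightarrow> max 0 u"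
      by (rule tendsto_sandwich[OF _ _ tendsto_const upper])
         (intro always_eventually allI less_imp_le s_gt s_le)+
    moreover have "\<forall>\<^sub>F n in sequentially. s n u \<in> {max 0 u<..} \<and> s n u \<noteq> max 0 u"
      using s_gt[of u] by (intro always_eventually allI) (metis greaterThan_iff less_irrefl)
    ultimately show ?thesis
      by (simp only: filterlim_at simp_thms)
  qed
  have "(\<lambda>(u, \<omega>). Y u \<omega>) \<in> borel_measurable (borel \<Otimes>\<^sub>M M)"
  proof (rule borel_measurable_LIMSEQ_metric)
    fix n
    \<comment> \<open>The discretised time takes only countably many values, so measurability at
      each fixed time suffices.\<close>
    have "(\<lambda>p. (\<lambda>k p. Y (real (k + 1) / real (Suc n)) (snd p))
            (nat \<lfloor>real (Suc n) * max 0 (fst p)\<rfloor>) p) \<in> borel_measurable (borel \<Otimes>\<^sub>M M)"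
      by (rule measurable_compose_countable) measurable
    then show "(\<lambda>(u, \<omega>). Y (s n u) \<omega>) \<in> borel_measurable (borel \<Otimes>\<^sub>M M)"
      by (simp add: s_def case_prod_beta')
  next
    fix p :: "real \<times> 'a" assume p: "p \<in> space (borel \<Otimes>\<^sub>M M)"
    obtain u \<omega> where [simp]: "p = (u, \<omega>)" by (cases p)
    have "(\<lambda>n. Y (s n u) \<omega>) \<longlonglongrightarrow> Y u \<omega>"
    proof (cases "\<omega> \<in> N")
      case False
      then have "cadlag (\<lambda>t. X t \<omega>)" using N p by (auto simp: space_pair_measure)
      then have "((\<lambda>t. X t \<omega>) \<longlongrightarrow> X (max 0 u) \<omega>) (at_right (max 0 u))"
        by (auto simp: cadlag_def)
      from filterlim_compose[OF this s_lim] have "(\<lambda>n. X (s n u) \<omega>) \<longlonglongrightarrow> X (max 0 u) \<omega>" .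
      moreover have "max 0 (s n u) = s n u" for n
        using s_gt[of u n] by linarith
      ultimately show ?thesis using False by (simp add: Y_def)
    qed (simp add: Y_def)
    then show "(\<lambda>n. case p of (u, \<omega>) \<Rightarrow> Y (s n u) \<omega>) \<longlonglongrightarrow> (case p of (u, \<omega>) \<Rightarrow> Y u \<omega>)"
      by simp
  qed
  moreover have "AE \<omega> in M. \<forall>u\<ge>0. Y u \<omega> = X u \<omega>"
    using AE_not_in[OF N(2)] by eventually_elim (auto simp: Y_def)
  ultimately show ?thesis using that by blast
qed

text \<open>At each fixed nonnegative time the jointly measurable version may replace
  \<open>X\<close> under the integral; the clamp keeps the time where the two agree.\<close>

lemma transition_measurable:
  assumes [measurable]: "Q \<in> borel_measurable borel"
  shows "(\<lambda>(u, z). transition (max 0 u) Q z) \<in> borel_measurable (borel \<Otimes>\<^sub>M borel)"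
proof -
  obtain Y where [measurable]: "(\<lambda>(u, \<omega>). Y u \<omega>) \<in> borel_measurable (borel \<Otimes>\<^sub>M M)"
    and Y: "AE \<omega> in M. \<forall>u\<ge>0. Y u \<omega> = X u \<omega>"
    by (rule ex_jointly_measurable_version)
  have "transition (max 0 u) Q z = (\<integral>\<^sup>+\<omega>. Q (Y (max 0 u) \<omega> + z) \<partial>M)" for u z
    unfolding transition_def by (rule nn_integral_cong_AE) (use Y in eventually_elim, auto)
  moreover have "(\<lambda>p. \<integral>\<^sup>+\<omega>. Q (Y (max 0 (fst p)) \<omega> + snd p) \<partial>M) \<in> borel_measurable (borel \<Otimes>\<^sub>M borel)"
    by measurable
  ultimately show ?thesis by (simp add: case_prod_beta')
qed

text \<open>Fubini for the jointly measurable version. Both expectations in the theorem thereby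
  become time integrals of \<open>transition\<close>.\<close>

lemma expectation_from_time_integral:
  assumes [measurable]: "Q \<in> borel_measurable borel" "S \<in> sets borel" and S: "S \<subseteq> {0..}"
  shows "expectation_from M X x (\<lambda>Y. \<integral>\<^sup>+u\<in>S. Q (Y u) \<partial>lborel) = (\<integral>\<^sup>+u\<in>S. transition u Q x \<partial>lborel)"
proof -
  obtain Y where [measurable]: "(\<lambda>(u, \<omega>). Y u \<omega>) \<in> borel_measurable (borel \<Otimes>\<^sub>M M)"
    and Y: "AE \<omega> in M. \<forall>u\<ge>0. Y u \<omega> = X u \<omega>"
    by (rule ex_jointly_measurable_version)
  interpret P: pair_sigma_finite lborel M by unfold_locales
  have "expectation_from M X x (\<lambda>Y. \<integral>\<^sup>+u\<in>S. Q (Y u) \<partial>lborel)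
    = (\<integral>\<^sup>+\<omega>. \<integral>\<^sup>+u. Q (Y u \<omega> + x) * indicator S u \<partial>lborel \<partial>M)"
    unfolding expectation_from_def
    by (rule nn_integral_cong_AE)
       (use Y in eventually_elim, use S in \<open>auto intro!: nn_integral_cong split: split_indicator\<close>)
  also have "\<dots> = (\<integral>\<^sup>+u. \<integral>\<^sup>+\<omega>. Q (Y u \<omega> + x) * indicator S u \<partial>M \<partial>lborel)"
    by (rule P.Fubini') measurable
  also have "\<dots> = (\<integral>\<^sup>+u\<in>S. transition u Q x \<partial>lborel)"
  proof (rule nn_integral_cong)
    fix u
    show "(\<integral>\<^sup>+\<omega>. Q (Y u \<omega> + x) * indicator S u \<partial>M) = transition u Q x * indicator S u"
    proof (cases "u \<in> S")
      case True
      then have "0 \<le> u" using S by auto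
      then have "(\<integral>\<^sup>+\<omega>. Q (Y u \<omega> + x) \<partial>M) = transition u Q x"
        unfolding transition_def by (intro nn_integral_cong_AE) (use Y in eventually_elim, auto)
      then show ?thesis using True by simp
    qed simp
  qed
  finally show ?thesis .
qed

section \<open>The Markov property at the first passage along a grid\<close>

text \<open>The last increment is independent of the earlier ones and, by stationarity, distributed
  as \<open>X\<close> at the length of the time step. It can therefore be replaced by an independent
  copy, integrated over a second \<open>\<omega>'\<close>.\<close>

lemma nn_integral_increments:
  fixes t :: "nat \<Rightarrow> real"
  defines "D \<equiv> \<lambda>i \<omega>. X (t (Suc i)) \<omega> - X (t i) \<omega>"
  assumes t: "0 \<le> t 0" "strict_mono_on {..Suc j} t"
    and G [measurable]: "G \<in> borel_measurable (PiM {..<j} (\<lambda>_. borel) \<Otimes>\<^sub>M borel)"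
  shows "(\<integral>\<^sup>+\<omega>. G (\<lambda>i\<in>{..<j}. D i \<omega>, D j \<omega>) \<partial>M)
    = (\<integral>\<^sup>+\<omega>. \<integral>\<^sup>+\<omega>'. G (\<lambda>i\<in>{..<j}. D i \<omega>, X (t (Suc j) - t j) \<omega>') \<partial>M \<partial>M)"
proof -
  let ?V = "\<lambda>\<omega>. \<lambda>i\<in>{..<j}. D i \<omega>" and ?P = "PiM {..<j} (\<lambda>_. borel :: 'v measure)"
  \<comment> \<open>Independence is obtained between two blocks of increments, so the last increment
    is treated as a block with the single index \<open>j\<close>.\<close>
  let ?W = "\<lambda>\<omega>. \<lambda>i\<in>{j}. D i \<omega>" and ?S = "PiM {j} (\<lambda>_. borel :: 'v measure)"
  have nonneg: "0 \<le> t i" if "i \<le> Suc j" for i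
    using t strict_mono_on_leD[OF t(2), of 0 i] that by auto
  have tj: "t j < t (Suc j)" using t by (auto simp: strict_mono_on_def)
  have D [measurable]: "D i \<in> borel_measurable M" if "i \<le> j" for i
    unfolding D_def using nonneg that by (intro borel_measurable_diff rv) auto
  have V [measurable]: "?V \<in> M \<rightarrow>\<^sub>M ?P"
    by (rule measurable_restrict) (auto intro: D)
  have W [measurable]: "?W \<in> M \<rightarrow>\<^sub>M ?S"
    by (rule measurable_restrict) (auto intro: D)
  have [measurable]: "(\<lambda>w. w j) \<in> ?S \<rightarrow>\<^sub>M borel" by measurable
  have Xh [measurable]: "X (t (Suc j) - t j) \<in> borel_measurable M"
    using tj by (intro rv) auto
  have "indep_vars (\<lambda>_. borel) D {..<Suc j}"
    unfolding D_def using t by (intro indep_increments) auto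
  then have "indep_var ?P ?V ?S ?W"
    by (rule indep_var_restrict) auto
  then have prod: "distr M ?P ?V \<Otimes>\<^sub>M distr M ?S ?W = distr M (?P \<Otimes>\<^sub>M ?S) (\<lambda>\<omega>. (?V \<omega>, ?W \<omega>))"
    by (simp add: indep_var_distribution_eq)
  have stat: "distr M borel (D j) = distr M borel (X (t (Suc j) - t j))"
    using stationary_increments[of "t j" "t (Suc j) - t j"] nonneg[of j] tj by (simp add: D_def)
  have D_X: "(\<integral>\<^sup>+\<omega>. f (D j \<omega>) \<partial>M) = (\<integral>\<^sup>+\<omega>. f (X (t (Suc j) - t j) \<omega>) \<partial>M)"
    if "f \<in> borel_measurable borel" for f :: "'v \<Rightarrow> ennreal"
    using that nn_integral_distr[of "D j" M borel f] nn_integral_distr[of "X (t (Suc j) - t j)" M borel f]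
    by (simp add: stat)
  interpret W: prob_space "distr M ?S ?W"
    by (rule prob_space_distr) simp
  have "(\<integral>\<^sup>+\<omega>. G (?V \<omega>, D j \<omega>) \<partial>M)
    = (\<integral>\<^sup>+p. G (fst p, snd p j) \<partial>distr M (?P \<Otimes>\<^sub>M ?S) (\<lambda>\<omega>. (?V \<omega>, ?W \<omega>)))"
    by (subst nn_integral_distr) auto
  also have "\<dots> = (\<integral>\<^sup>+v. \<integral>\<^sup>+w. G (v, w j) \<partial>distr M ?S ?W \<partial>distr M ?P ?V)"
    unfolding prod[symmetric] by (subst W.nn_integral_fst[symmetric]) auto
  also have "\<dots> = (\<integral>\<^sup>+v. \<integral>\<^sup>+\<omega>'. G (v, X (t (Suc j) - t j) \<omega>') \<partial>M \<partial>distr M ?P ?V)"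
  proof (rule nn_integral_cong)
    fix v assume "v \<in> space (distr M ?P ?V)"
    then have [simp]: "v \<in> space ?P" by simp
    have "(\<integral>\<^sup>+w. G (v, w j) \<partial>distr M ?S ?W) = (\<integral>\<^sup>+\<omega>'. G (v, D j \<omega>') \<partial>M)"
      by (subst nn_integral_distr) auto
    also have "\<dots> = (\<integral>\<^sup>+\<omega>'. G (v, X (t (Suc j) - t j) \<omega>') \<partial>M)"
      by (intro D_X) measurable
    finally show "(\<integral>\<^sup>+w. G (v, w j) \<partial>distr M ?S ?W) = (\<integral>\<^sup>+\<omega>'. G (v, X (t (Suc j) - t j) \<omega>') \<partial>M)" .
  qed
  also have "\<dots> = (\<integral>\<^sup>+\<omega>. \<integral>\<^sup>+\<omega>'. G (?V \<omega>, X (t (Suc j) - t j) \<omega>') \<partial>M \<partial>M)"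
    by (subst nn_integral_distr) auto
  finally show ?thesis .
qed

text \<open>Only grid times up to \<open>t j\<close> are inspected, so that the event is decided by
  finitely many increments. The events for different \<open>j\<close> are disjoint.\<close>

definition first_passage :: "(nat \<Rightarrow> real) \<Rightarrow> real \<Rightarrow> nat \<Rightarrow> 'a set" where
  "first_passage t a j =
     {\<omega> \<in> space M. (\<forall>k<j. norm (X (t k) \<omega>) < a) \<and> a \<le> norm (X (t j) \<omega>)}"

lemma first_passage_sets [measurable]:
  assumes "\<And>k. 0 \<le> t k"
  shows "first_passage t a j \<in> sets M"
proof -
  have [measurable]: "X (t k) \<in> borel_measurable M" for k using assms by (rule rv)
  show ?thesis unfolding first_passage_def by measurable
qed

text \<open>Since the process starts at 0, a first passage at \<open>t j\<close> is a function of
  the increments up to \<open>t j\<close>, while \<open>X u - X (t j)\<close> is independent of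
  them. This takes the place of the strong Markov property.\<close>

lemma markov_first_passage:
  assumes t: "t 0 = 0" "strict_mono t" and u: "t j < u"
    and Q [measurable]: "Q \<in> borel_measurable borel"
  shows "(\<integral>\<^sup>+\<omega>\<in>first_passage t a j. Q (X u \<omega> + x) \<partial>M)
    = (\<integral>\<^sup>+\<omega>\<in>first_passage t a j. transition (u - t j) Q (X (t j) \<omega> + x) \<partial>M)"
proof -
  \<comment> \<open>The grid point following \<open>t j\<close> is moved to \<open>u\<close>, which
    need not lie on the grid, so that the last increment is \<open>X u - X (t j)\<close>.\<close>
  define t' where "t' = t(Suc j := u)"
  let ?V = "\<lambda>\<omega>. \<lambda>i\<in>{..<j}. X (t' (Suc i)) \<omega> - X (t' i) \<omega>"
  let ?P = "PiM {..<j} (\<lambda>_. borel :: 'v measure)"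
  define S where "S k v = (\<Sum>i<k. v i)" for k :: nat and v :: "nat \<Rightarrow> 'v"
  \<comment> \<open>Here \<open>v\<close> stands for the increments and \<open>w\<close> for the
    last one. The partial sums \<open>S k v\<close> recover \<open>X (t k)\<close>, and the
    conditional factor is the indicator of the first passage.\<close>
  define G where "G = (\<lambda>(v, w). Q (w + S j v + x) *
    (if (\<forall>k\<in>{..<j}. norm (S k v) < a) \<and> a \<le> norm (S j v) then 1 else 0))"
  have mono: "strict_mono_on {..Suc j} t'"
    using t(2) u by (auto simp: t'_def strict_mono_on_def strict_monoD less_Suc_eq_le
        intro: le_less_trans[OF strict_mono_leD[OF t(2)] u])
  have [measurable]: "(\<lambda>p. S k (fst p)) \<in> borel_measurable (?P \<Otimes>\<^sub>M (borel :: 'v measure))" if "k \<le> j" for k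
    unfolding S_def using that by (intro borel_measurable_sum) measurable
  have [measurable]: "Measurable.pred (?P \<Otimes>\<^sub>M (borel :: 'v measure)) (\<lambda>p. \<forall>k\<in>{..<j}. norm (S k (fst p)) < a)"
    by (rule pred_intros_finite) (auto intro!: measurable)
  have G: "G \<in> borel_measurable (?P \<Otimes>\<^sub>M borel)"
    unfolding G_def case_prod_beta' by measurable
  have S: "AE \<omega> in M. \<forall>k\<le>j. S k (?V \<omega>) = X (t k) \<omega>"
    using start
  proof eventually_elim
    case (elim \<omega>)
    have "S k (?V \<omega>) = X (t k) \<omega>" if "k \<le> j" for k
    proof -
      have "S k (?V \<omega>) = (\<Sum>i<k. X (t (Suc i)) \<omega> - X (t i) \<omega>)"
        unfolding S_def t'_def using that by (intro sum.cong) auto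
      then show ?thesis
        using elim t(1) by (simp add: sum_lessThan_telescope[of "\<lambda>i. X (t i) \<omega>"])
    qed
    then show ?case by blast
  qed
  have "(\<integral>\<^sup>+\<omega>\<in>first_passage t a j. Q (X u \<omega> + x) \<partial>M) = (\<integral>\<^sup>+\<omega>. G (?V \<omega>, X (t' (Suc j)) \<omega> - X (t' j) \<omega>) \<partial>M)"
    by (rule nn_integral_cong_AE, use S AE_space in eventually_elim)
       (auto simp: G_def first_passage_def t'_def split: split_indicator)
  also have "\<dots> = (\<integral>\<^sup>+\<omega>. \<integral>\<^sup>+\<omega>'. G (?V \<omega>, X (t' (Suc j) - t' j) \<omega>') \<partial>M \<partial>M)"
    using t by (intro nn_integral_increments mono G) (simp add: t'_def)
  also have "\<dots> = (\<integral>\<^sup>+\<omega>\<in>first_passage t a j. transition (u - t j) Q (X (t j) \<omega> + x) \<partial>M)"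
    by (rule nn_integral_cong_AE, use S AE_space in eventually_elim)
       (auto simp: G_def first_passage_def t'_def transition_def add.assoc split: split_indicator)
  finally show ?thesis .
qed

section \<open>Small displacements in short times\<close>

lemma eventually_prob_norm_ge_small:
  assumes "0 < a" "0 < e"
  obtains \<delta> where "0 < \<delta>" "\<And>h. 0 \<le> h \<Longrightarrow> h \<le> \<delta> \<Longrightarrow> prob {\<omega> \<in> space M. a \<le> norm (X h \<omega>)} \<le> e"
proof -
  \<comment> \<open>Halving \<open>a\<close> turns the non-strict bound of the claim into the strict
    one of stochastic continuity.\<close>
  let ?p = "\<lambda>s. prob {\<omega> \<in> space M. a / 2 < dist (X s \<omega>) (X 0 \<omega>)}"
  have "\<forall>\<^sub>F s in at 0 within {0..}. ?p s < e"
    using stochastically_continuous[of 0 "a / 2"] assms by (auto intro: order_tendstoD)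
  then obtain d where d: "0 < d" "\<And>s. s \<ge> 0 \<Longrightarrow> s \<noteq> 0 \<Longrightarrow> dist s 0 < d \<Longrightarrow> ?p s < e"
    unfolding eventually_at by auto
  have "prob {\<omega> \<in> space M. a \<le> norm (X h \<omega>)} \<le> e" if h: "0 \<le> h" "h \<le> d / 2" for h
  proof -
    have [measurable]: "X h \<in> borel_measurable M" "X 0 \<in> borel_measurable M" using h rv by auto
    have "prob {\<omega> \<in> space M. a \<le> norm (X h \<omega>)} \<le> ?p h"
      by (rule finite_measure_mono_AE, use start in eventually_elim) (use assms in auto)
    also have "?p h \<le> e"
    proof (cases "h = 0")
      case True
      then show ?thesis using assms by simp
    next
      case False
      then show ?thesis using d(2)[of h] h d(1) by auto
    qed
    finally show ?thesis .
  qed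
  then show ?thesis using that[of "d / 2"] d(1) by auto
qed

text \<open>Stochastic continuity controls a single time only, whereas \<open>T\<close> must serve
  all grids at once. By right-continuity at 0, the events of leaving the ball at some rational time
  in a shrinking interval decrease to a null set, so their probabilities tend to 0.\<close>

lemma prob_grid_passage_small:
  assumes "0 < a" "0 < r"
  obtains T where "0 < T" "T \<le> r"
    "\<And>n. prob {\<omega> \<in> space M. \<exists>j\<le>Suc n. a \<le> norm (X (real j * T / real (Suc n)) \<omega>)} \<le> 1 / 2"
proof -
  \<comment> \<open>Rational times keep the event measurable; \<open>T\<close> is chosen rational so that all grids are rational.\<close>
  define R where "R m = {0..1 / real (Suc m)} \<inter> \<rat>" for m
  define B where "B m = {\<omega> \<in> space M. \<exists>p\<in>R m. a \<le> norm (X p \<omega>)}" for m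
  have countable: "countable (R m)" for m
    unfolding R_def using countable_rat by blast
  have Rm: "random_variable borel (X p)" if "p \<in> R m" for p m
    using that by (intro rv) (auto simp: R_def)
  have B [measurable]: "B m \<in> sets M" for m
  proof -
    have "B m = (\<Union>p\<in>R m. {\<omega> \<in> space M. a \<le> norm (X p \<omega>)})"
      by (auto simp: B_def)
    moreover have "{\<omega> \<in> space M. a \<le> norm (X p \<omega>)} \<in> sets M" if "p \<in> R m" for p
      using Rm[OF that] by measurable
    ultimately show ?thesis using countable by (auto intro!: sets.countable_UN')
  qed
  have "AE \<omega> in M. \<omega> \<notin> (\<Inter>m. B m)"
    using start cadlag_paths
  proof eventually_elim
    case (elim \<omega>)
    have "((\<lambda>t. X t \<omega>) \<longlongrightarrow> 0) (at_right 0)"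
      using elim by (auto simp: cadlag_def dest!: spec[of _ 0])
    then have "\<forall>\<^sub>F s in at_right 0. norm (X s \<omega>) < a"
      using assms by (intro order_tendstoD(2)[OF tendsto_norm_zero])
    then obtain d where d: "0 < d" "\<And>s. 0 < s \<Longrightarrow> s < d \<Longrightarrow> norm (X s \<omega>) < a"
      unfolding eventually_at_right_field by auto
    obtain m where "1 / real (Suc m) < d"
      using d(1) reals_Archimedean[of d] by (auto simp: inverse_eq_divide)
    then have "norm (X p \<omega>) < a" if "p \<in> R m" for p
      using that d elim assms by (cases "p = 0") (auto simp: R_def)
    then have "\<omega> \<notin> B m" by (force simp: B_def)
    then show ?case by blast
  qed
  then have "prob (\<Inter>m. B m) = 0"
    by (subst prob_eq_0) auto
  moreover have "decseq B"
  proof (rule decseq_SucI)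
    fix m
    have "1 / real (Suc (Suc m)) \<le> 1 / real (Suc m)" by (simp add: field_simps)
    then have "R (Suc m) \<subseteq> R m" unfolding R_def by force
    then show "B (Suc m) \<subseteq> B m" unfolding B_def by blast
  qed
  ultimately have "(\<lambda>m. prob (B m)) \<longlonglongrightarrow> 0"
    using finite_Lim_measure_decseq[of B] B by (metis image_subsetI)
  then have "\<forall>\<^sub>F m in sequentially. prob (B m) < 1 / 2"
    by (rule order_tendstoD) simp
  moreover have "\<forall>\<^sub>F m in sequentially. 1 / real (Suc m) < r"
    using LIMSEQ_Suc[OF lim_1_over_n] assms(2) by (intro order_tendstoD(2)[where y = 0]) auto
  ultimately have "\<forall>\<^sub>F m in sequentially. prob (B m) < 1 / 2 \<and> 1 / real (Suc m) < r"
    by (rule eventually_conj)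
  then obtain m where m: "prob (B m) < 1 / 2" "1 / real (Suc m) < r"
    by (auto simp: eventually_sequentially)
  show ?thesis
  proof (rule that[of "1 / real (Suc m)"])
    fix n
    have "real j * (1 / real (Suc m)) / real (Suc n) \<in> R m" if "j \<le> Suc n" for j
    proof -
      have "real j * (1 / real (Suc m)) \<le> real (Suc n) * (1 / real (Suc m))"
        using that by (intro mult_right_mono) auto
      then show ?thesis
        unfolding R_def by (auto simp: divide_le_eq mult.commute simp del: of_nat_Suc)
    qed
    then have "{\<omega> \<in> space M. \<exists>j\<le>Suc n. a \<le> norm (X (real j * (1 / real (Suc m)) / real (Suc n)) \<omega>)} \<subseteq> B m"
      unfolding B_def by blast
    then have "prob {\<omega> \<in> space M. \<exists>j\<le>Suc n. a \<le> norm (X (real j * (1 / real (Suc m)) / real (Suc n)) \<omega>)} \<le> prob (B m)"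
      by (rule finite_measure_mono) simp
    also have "\<dots> \<le> 1 / 2" using m by simp
    finally show "prob {\<omega> \<in> space M. \<exists>j\<le>Suc n. a \<le> norm (X (real j * (1 / real (Suc m)) / real (Suc n)) \<omega>)} \<le> 1 / 2" .
  qed (use m in auto)
qed

section \<open>Occupation integrals and the comparison for bounded functions\<close>

text \<open>By \<open>expectation_from_time_integral\<close>, this is the expectation from
  \<open>x\<close> of the integral of \<open>Q\<close> along the path up to time \<open>T\<close>,
  for measurable \<open>Q\<close>.\<close>

definition occupation :: "real \<Rightarrow> ('v \<Rightarrow> ennreal) \<Rightarrow> 'v \<Rightarrow> ennreal" where
  "occupation T Q x = (\<integral>\<^sup>+u\<in>{0..T}. transition u Q x \<partial>lborel)"

text \<open>Joint measurability is available only after clamping the time to the half-line.\<close>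

lemma occupation_alt: "occupation T Q x = (\<integral>\<^sup>+u\<in>{0..T}. transition (max 0 u) Q x \<partial>lborel)"
  unfolding occupation_def by (intro nn_integral_cong) (auto split: split_indicator)

lemma occupation_mono: "T \<le> T' \<Longrightarrow> (\<And>y. Q y \<le> Q' y) \<Longrightarrow> occupation T Q x \<le> occupation T' Q' x"
  unfolding occupation_def transition_def
  by (intro nn_integral_mono mult_mono) (auto split: split_indicator)

lemma occupation_le:
  assumes "\<And>y. Q y \<le> ennreal c" "0 \<le> T"
  shows "occupation T Q x \<le> ennreal c * ennreal T"
proof -
  have "transition u Q x \<le> ennreal c" for u
  proof -
    have "transition u Q x \<le> (\<integral>\<^sup>+\<omega>. ennreal c \<partial>M)"
      unfolding transition_def by (intro nn_integral_mono assms)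
    then show ?thesis by (simp add: emeasure_space_1)
  qed
  then have "occupation T Q x \<le> (\<integral>\<^sup>+u\<in>{0..T}. ennreal c \<partial>lborel)"
    unfolding occupation_def by (intro nn_integral_mono mult_right_mono) auto
  then show ?thesis using assms by (simp add: nn_integral_cmult)
qed

text \<open>After exchanging the integrals and shifting time by \<open>t j\<close>, the remaining
  window lies in \<open>{0..T}\<close>. The inner integral is then at most the supremum of
  \<open>occupation T Q\<close>, whatever the position at the passage.\<close>

lemma first_passage_integral_le:
  assumes t: "t 0 = 0" "strict_mono t"
    and [measurable]: "Q \<in> borel_measurable borel"
  shows "(\<integral>\<^sup>+u\<in>{t j<..T}. (\<integral>\<^sup>+\<omega>\<in>first_passage t a j. transition (max 0 (u - t j)) Q (X (t j) \<omega> + x) \<partial>M) \<partial>lborel)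
    \<le> emeasure M (first_passage t a j) * (SUP y. occupation T Q y)"
proof -
  have tn: "0 \<le> t k" for k
    using t strict_mono_less_eq[OF t(2), of 0 k] by simp
  note transition_measurable[measurable]
  have [measurable]: "X (t j) \<in> borel_measurable M" "first_passage t a j \<in> sets M"
    using tn by (auto intro: rv)
  have [measurable]: "(\<lambda>p. transition (max 0 (f p)) Q (g p)) \<in> borel_measurable N"
    if [measurable]: "f \<in> borel_measurable N" "g \<in> borel_measurable N"
    for f g and N :: "'c measure"
    using measurable_compose[of "\<lambda>p. (f p, g p)" N _ "\<lambda>(u, z). transition (max 0 u) Q z", OF _ transition_measurable]
    by simp
  interpret P: pair_sigma_finite lborel M by unfold_locales
  let ?F = "first_passage t a j"
  have shift: "(\<integral>\<^sup>+u. transition (max 0 (u - t j)) Q z * indicator {t j<..T} u \<partial>lborel) \<le> occupation T Q z" for z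
  proof -
    have "(\<integral>\<^sup>+u. transition (max 0 (u - t j)) Q z * indicator {t j<..T} u \<partial>lborel)
      = (\<integral>\<^sup>+u. transition (max 0 u) Q z * indicator {t j<..T} (t j + u) \<partial>lborel)"
      by (subst nn_integral_real_affine[where c = 1 and t = "t j"]) auto
    also have "\<dots> \<le> occupation T Q z"
      unfolding occupation_alt using tn[of j]
      by (intro nn_integral_mono mult_left_mono) (auto split: split_indicator)
    finally show ?thesis .
  qed
  have "(\<integral>\<^sup>+u\<in>{t j<..T}. (\<integral>\<^sup>+\<omega>\<in>?F. transition (max 0 (u - t j)) Q (X (t j) \<omega> + x) \<partial>M) \<partial>lborel)
    = (\<integral>\<^sup>+u. \<integral>\<^sup>+\<omega>. transition (max 0 (u - t j)) Q (X (t j) \<omega> + x) * indicator ?F \<omega> * indicator {t j<..T} u \<partial>M \<partial>lborel)"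
    by (intro nn_integral_cong nn_integral_multc[symmetric]) measurable
  also have "\<dots> = (\<integral>\<^sup>+\<omega>. \<integral>\<^sup>+u. transition (max 0 (u - t j)) Q (X (t j) \<omega> + x) * indicator ?F \<omega> * indicator {t j<..T} u \<partial>lborel \<partial>M)"
    by (rule P.Fubini'[symmetric]) measurable
  also have "\<dots> = (\<integral>\<^sup>+\<omega>. (\<integral>\<^sup>+u. transition (max 0 (u - t j)) Q (X (t j) \<omega> + x) * indicator {t j<..T} u \<partial>lborel) * indicator ?F \<omega> \<partial>M)"
    by (intro nn_integral_cong) (auto split: split_indicator)
  also have "\<dots> \<le> (\<integral>\<^sup>+\<omega>. (SUP y. occupation T Q y) * indicator ?F \<omega> \<partial>M)"
    by (intro nn_integral_mono mult_right_mono order_trans[OF shift] SUP_upper) auto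
  also have "\<dots> = emeasure M ?F * (SUP y. occupation T Q y)"
    by (simp add: nn_integral_cmult_indicator mult.commute)
  finally show ?thesis .
qed

text \<open>The radius doubles because the exit is watched on the grid only: if the last grid
  position has norm below \<open>a\<close> and the increment since then does too, the process is
  still within \<open>2 * a\<close> of its start. Passages contribute at most half of the left-hand
  side, and large increments between grid times an arbitrarily small error.\<close>

lemma occupation_le_bounded:
  fixes Q :: "'v \<Rightarrow> ennreal"
  assumes [measurable]: "Q \<in> borel_measurable borel" and Qc: "\<And>y. Q y \<le> ennreal c" and c: "0 \<le> c"
    and "0 < a" "0 < T"
    and passage: "\<And>n. prob {\<omega> \<in> space M. \<exists>j\<le>Suc n. a \<le> norm (X (real j * T / real (Suc n)) \<omega>)} \<le> 1 / 2"
  shows "(SUP x. occupation T Q x)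
    \<le> 2 * (SUP x. occupation T (\<lambda>y. indicator (ball x (2 * a)) y * Q y) x)"
proof -
  define f where "f = (SUP x. occupation T Q x)"
  define K where "K = (SUP x. occupation T (\<lambda>y. indicator (ball x (2 * a)) y * Q y) x)"
  have "f \<le> ennreal c * ennreal T"
    unfolding f_def using Qc \<open>0 < T\<close> by (intro SUP_least occupation_le) auto
  \<comment> \<open>Finiteness allows the term \<open>f / 2\<close> to be absorbed at the end; this is where boundedness of \<open>Q\<close> is needed.\<close>
  then have f_fin: "f < top"
    by (rule le_less_trans) (simp add: ennreal_mult_less_top)
  have "f \<le> (K + ennreal (1 / 2) * f) + ennreal e" if e: "0 < e" for e
  proof -
    \<comment> \<open>The error is at most \<open>c * e'\<close> per unit of time, hence at most
      \<open>e\<close> over \<open>{0..T}\<close>; the \<open>+ 1\<close> avoids division by zero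
      when \<open>c = 0\<close>.\<close>
    define e' where "e' = e / (c * T + 1)"
    have e': "0 < e'" "c * T * e' \<le> e"
    proof -
      have pos: "0 < c * T + 1" using c \<open>0 < T\<close> by (simp add: add_nonneg_pos)
      then show "0 < e'" using e by (simp add: e'_def)
      show "c * T * e' \<le> e" using pos e by (simp add: e'_def divide_le_eq algebra_simps)
    qed
    obtain \<delta> where \<delta>: "0 < \<delta>" "\<And>h. 0 \<le> h \<Longrightarrow> h \<le> \<delta> \<Longrightarrow> prob {\<omega> \<in> space M. a \<le> norm (X h \<omega>)} \<le> e'"
      using eventually_prob_norm_ge_small[OF \<open>0 < a\<close> e'(1)] by blast
    obtain n where n: "T / real (Suc n) \<le> \<delta>"
    proof -
      obtain n where "T / \<delta> < real n" using reals_Archimedean2 by blast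
      then have "T / real (Suc n) \<le> \<delta>" using \<delta>(1) \<open>0 < T\<close> by (simp add: field_simps)
      then show ?thesis by (rule that)
    qed
    define t where "t j = real j * T / real (Suc n)" for j
    have t: "t 0 = 0" "strict_mono t" and t_nonneg: "0 \<le> t j" for j
      using \<open>0 < T\<close> by (auto simp: t_def strict_mono_def divide_strict_right_mono)
    have [measurable]: "X (t j) \<in> borel_measurable M" "first_passage t a j \<in> sets M" for j
      using t_nonneg by (auto intro: rv)
    define F where "F j u x = (\<integral>\<^sup>+\<omega>\<in>first_passage t a j. transition (max 0 (u - t j)) Q (X (t j) \<omega> + x) \<partial>M)" for j u x
    let ?Qb = "\<lambda>x y. indicator (ball x (2 * a)) y * Q y"
    have Qb [measurable]: "?Qb x \<in> borel_measurable borel" for x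
      by (intro borel_measurable_times_ennreal borel_measurable_indicator) simp_all
    have step: "transition (max 0 u) Q x
      \<le> transition (max 0 u) (?Qb x) x + (\<Sum>j\<le>Suc n. F j u x * indicator {t j<..T} u) + ennreal (c * e')"
      if u: "u \<in> {0..T}" for u x
    proof -
      have [measurable]: "X u \<in> borel_measurable M" using u by (auto intro: rv)
      \<comment> \<open>For \<open>u > 0\<close>, \<open>t i\<close> is the last grid time strictly
        before \<open>u\<close>; strictness is what \<open>markov_first_passage\<close> requires.
        For \<open>u = 0\<close>, \<open>nat\<close> turns -1 into 0, so
        \<open>t i = u\<close>.\<close>
      define i where "i = nat (\<lceil>u * real (Suc n) / T\<rceil> - 1)"
      have i: "t i \<le> u" "u \<le> t i + T / real (Suc n)" "i \<le> Suc n" "u > 0 \<Longrightarrow> t i < u"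
      proof -
        let ?y = "u * real (Suc n) / T"
        have y: "0 \<le> ?y" "?y \<le> real (Suc n)" "0 < u \<Longrightarrow> 0 < ?y" "u = ?y * T / real (Suc n)"
          using u \<open>0 < T\<close> by (auto simp: divide_le_eq mult.commute mult_left_mono simp del: of_nat_Suc)
        have grid: "real i \<le> ?y" "?y \<le> real i + 1" "i \<le> Suc n" "0 < ?y \<Longrightarrow> real i < ?y"
          unfolding i_def using y(1,2) by linarith+
        have mono: "b * T / real (Suc n) \<le> b' * T / real (Suc n) \<longleftrightarrow> b \<le> b'" for b b'
          using \<open>0 < T\<close> by (simp add: divide_le_cancel)
        show "t i \<le> u" unfolding t_def by (subst y(4)) (simp only: mono grid)
        have "?y * T / real (Suc n) \<le> (real i + 1) * T / real (Suc n)" by (simp only: mono grid)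
        then show "u \<le> t i + T / real (Suc n)"
          unfolding t_def y(4)[symmetric] by (simp add: distrib_right add_divide_distrib)
        show "i \<le> Suc n" by (fact grid)
        show "t i < u" if "0 < u"
          unfolding t_def using grid(4)[OF y(3)[OF that]]
          by (subst y(4)) (simp only: mono not_le[symmetric] simp_thms)
      qed
      have [simp]: "0 \<le> u" using u by simp
      have [measurable]: "(\<lambda>\<omega>. ?Qb x (X u \<omega> + x)) \<in> borel_measurable M"
        by (rule measurable_compose[OF _ Qb]) measurable
      \<comment> \<open>The time elapsed since \<open>t i\<close> is at most the mesh, hence at most
        \<open>\<delta>\<close>, so stationarity bounds the probability of \<open>B\<close> by
        \<open>e'\<close>.\<close>
      define B where "B = {\<omega> \<in> space M. a \<le> norm (X u \<omega> - X (t i) \<omega>)}"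
      have [measurable]: "B \<in> sets M" unfolding B_def by measurable
      have "measure (distr M borel (\<lambda>\<omega>. X (t i + (u - t i)) \<omega> - X (t i) \<omega>)) {y. a \<le> norm y}
          = measure (distr M borel (X (u - t i))) {y. a \<le> norm y}"
        using i t_nonneg by (subst stationary_increments) auto
      then have "prob B = prob {\<omega> \<in> space M. a \<le> norm (X (u - t i) \<omega>)}"
        using i rv[of "u - t i"]
        by (simp add: measure_distr B_def vimage_def Int_def conj_commute)
      also have "\<dots> \<le> e'" using i n by (intro \<delta>) auto
      finally have B: "emeasure M B \<le> ennreal e'"
        by (simp add: emeasure_eq_measure ennreal_leI)
      have "AE \<omega> in M. Q (X u \<omega> + x) \<le> ?Qb x (X u \<omega> + x)
          + (\<Sum>j\<le>Suc n. Q (X u \<omega> + x) * indicator (first_passage t a j) \<omega> * indicator {t j<..T} u)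
          + ennreal c * indicator B \<omega>"
        using start AE_space
      proof eventually_elim
        case (elim \<omega>)
        \<comment> \<open>inside the ball; a large jump since the last grid time; or a passage seen by the grid\<close>
        consider "norm (X u \<omega>) < 2 * a" | "\<omega> \<in> B" | "0 < u" "a \<le> norm (X (t i) \<omega>)"
        proof (cases "u = 0")
          case True
          then show ?thesis using that elim \<open>0 < a\<close> by simp
        next
          case False
          have "norm (X u \<omega>) \<le> norm (X u \<omega> - X (t i) \<omega>) + norm (X (t i) \<omega>)"
            by (metis diff_add_cancel norm_triangle_ineq)
          then have "norm (X u \<omega>) < 2 * a \<or> a \<le> norm (X u \<omega> - X (t i) \<omega>) \<or> a \<le> norm (X (t i) \<omega>)"
            by linarith
          moreover have "0 < u" using False \<open>0 \<le> u\<close> by linarith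
          ultimately show ?thesis using that elim(2) unfolding B_def by blast
        qed
        then show ?case
        proof cases
          case 1
          then have "X u \<omega> + x \<in> ball x (2 * a)" by (simp add: dist_norm)
          then show ?thesis by (simp add: add.assoc)
        next
          case 2
          then show ?thesis using Qc[of "X u \<omega> + x"] by (simp add: add_increasing)
        next
          case 3
          \<comment> \<open>The first passage index is at most \<open>i\<close>, so
            \<open>t j \<le> t i < u\<close> and the corresponding summand alone dominates.\<close>
          define j where "j = (LEAST j. a \<le> norm (X (t j) \<omega>))"
          have j: "a \<le> norm (X (t j) \<omega>)" "j \<le> i" "\<And>k. k < j \<Longrightarrow> norm (X (t k) \<omega>) < a"
            unfolding j_def using 3 by (auto intro: LeastI Least_le dest: not_less_Least)
          then have "\<omega> \<in> first_passage t a j" using elim by (simp add: first_passage_def)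
          moreover have "t j < u"
            using strict_mono_leD[OF t(2) j(2)] i(4) 3 by simp
          ultimately have "Q (X u \<omega> + x) = Q (X u \<omega> + x) * indicator (first_passage t a j) \<omega> * indicator {t j<..T} u"
            using u by simp
          also have "\<dots> \<le> (\<Sum>j\<le>Suc n. Q (X u \<omega> + x) * indicator (first_passage t a j) \<omega> * indicator {t j<..T} u)"
            using j i by (intro member_le_sum) auto
          finally show ?thesis by (simp add: add_increasing add_increasing2)
        qed
      qed
      then have "transition u Q x \<le> (\<integral>\<^sup>+\<omega>. ?Qb x (X u \<omega> + x)
          + (\<Sum>j\<le>Suc n. Q (X u \<omega> + x) * indicator (first_passage t a j) \<omega> * indicator {t j<..T} u)
          + ennreal c * indicator B \<omega> \<partial>M)"
        unfolding transition_def by (rule nn_integral_mono_AE)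
      also have "\<dots> = transition u (?Qb x) x
          + (\<Sum>j\<le>Suc n. (\<integral>\<^sup>+\<omega>\<in>first_passage t a j. Q (X u \<omega> + x) \<partial>M) * indicator {t j<..T} u)
          + ennreal c * emeasure M B"
        unfolding transition_def
        by (subst nn_integral_add_sum_add) (simp_all add: nn_integral_multc nn_integral_cmult_indicator del: sum.atMost_Suc)
      \<comment> \<open>Where the time indicator is nonzero, \<open>t j < u\<close>: the Markov
        property applies and the clamp in \<open>F\<close> has no effect.\<close>
      also have "(\<Sum>j\<le>Suc n. (\<integral>\<^sup>+\<omega>\<in>first_passage t a j. Q (X u \<omega> + x) \<partial>M) * indicator {t j<..T} u)
          = (\<Sum>j\<le>Suc n. F j u x * indicator {t j<..T} u)"
        unfolding F_def
        by (intro sum.cong refl) (auto simp: markov_first_passage[OF t] max_def split: split_indicator)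
      also have "ennreal c * emeasure M B \<le> ennreal (c * e')"
        using B c e' by (simp add: ennreal_mult mult_left_mono)
      finally show ?thesis by (simp add: add_left_mono)
    qed
    have trans_meas [measurable]: "(\<lambda>u. transition (max 0 u) Q' x) \<in> borel_measurable borel"
      if "Q' \<in> borel_measurable borel" for Q' x
      using measurable_compose[of "\<lambda>u. (u, x)" borel, OF _ transition_measurable[OF that]] by simp
    have F_meas [measurable]: "(\<lambda>u. F j u x) \<in> borel_measurable borel" for j x
    proof -
      have "(\<lambda>p. transition (max 0 (fst p - t j)) Q (X (t j) (snd p) + x)) \<in> borel_measurable (borel \<Otimes>\<^sub>M M)"
        using measurable_compose[of "\<lambda>p. (fst p - t j, X (t j) (snd p) + x)" "borel \<Otimes>\<^sub>M M", OF _ transition_measurable]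
        by simp
      then show ?thesis unfolding F_def by measurable
    qed
    \<comment> \<open>The first passages are disjoint and all lie in the event bounded by
      \<open>passage\<close>; this is the source of the factor 1/2.\<close>
    have pass: "(\<Sum>j\<le>Suc n. emeasure M (first_passage t a j)) \<le> ennreal (1 / 2)"
    proof -
      have "disjoint_family_on (first_passage t a) {..Suc n}"
        unfolding disjoint_family_on_def first_passage_def
        by (auto, metis linorder_neqE_nat not_less)
      then have "(\<Sum>j\<le>Suc n. emeasure M (first_passage t a j)) = emeasure M (\<Union>j\<le>Suc n. first_passage t a j)"
        by (intro sum_emeasure) auto
      also have "\<dots> \<le> emeasure M {\<omega> \<in> space M. \<exists>j\<le>Suc n. a \<le> norm (X (t j) \<omega>)}"
        by (rule emeasure_mono) (auto simp: first_passage_def)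
      also have "\<dots> \<le> ennreal (1 / 2)"
        unfolding emeasure_eq_measure t_def by (intro ennreal_leI passage)
      finally show ?thesis .
    qed
    have "occupation T Q x \<le> (K + ennreal (1 / 2) * f) + ennreal e" for x
    proof -
      have "occupation T Q x \<le> (\<integral>\<^sup>+u. transition (max 0 u) (?Qb x) x * indicator {0..T} u
          + (\<Sum>j\<le>Suc n. F j u x * indicator {t j<..T} u) + ennreal (c * e') * indicator {0..T} u \<partial>lborel)"
        unfolding occupation_alt
        using step by (intro nn_integral_mono) (auto split: split_indicator)
      also have "\<dots> = occupation T (?Qb x) x
          + (\<Sum>j\<le>Suc n. \<integral>\<^sup>+u\<in>{t j<..T}. F j u x \<partial>lborel) + ennreal (c * e') * ennreal T"
        unfolding occupation_alt using \<open>0 < T\<close>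
        by (subst nn_integral_add_sum_add) (simp_all add: nn_integral_cmult_indicator del: sum.atMost_Suc)
      also have "\<dots> \<le> K + (\<Sum>j\<le>Suc n. emeasure M (first_passage t a j) * f) + ennreal e"
      proof (intro add_mono sum_mono)
        show "occupation T (?Qb x) x \<le> K" unfolding K_def by (rule SUP_upper) simp
        show "(\<integral>\<^sup>+u\<in>{t j<..T}. F j u x \<partial>lborel) \<le> emeasure M (first_passage t a j) * f" for j
          unfolding F_def f_def by (intro first_passage_integral_le t) simp
        show "ennreal (c * e') * ennreal T \<le> ennreal e"
          using e' c \<open>0 < T\<close> by (simp add: mult.commute mult.left_commute ennreal_leI flip: ennreal_mult)
      qed
      also have "(\<Sum>j\<le>Suc n. emeasure M (first_passage t a j) * f) \<le> ennreal (1 / 2) * f"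
        unfolding sum_distrib_right[symmetric] by (intro mult_right_mono pass) simp
      finally show ?thesis by (simp add: add_left_mono add_right_mono)
    qed
    then show ?thesis unfolding f_def[symmetric] by (subst f_def) (rule SUP_least)
  qed
  then have "f \<le> K + ennreal (1 / 2) * f"
    by (rule ennreal_le_epsilon)
  moreover have "f \<le> 2 * K" if "f \<le> K + ennreal (1 / 2) * f"
  \<comment> \<open>For \<open>K = top\<close> the bound is trivial; otherwise all quantities are
    real and \<open>f / 2\<close> can be subtracted.\<close>
  proof (cases K)
    case (real k)
    obtain r where r: "f = ennreal r" "0 \<le> r" using f_fin by (cases f) auto
    have "ennreal r \<le> ennreal (k + 1 / 2 * r)"
      using that r real by (simp only: ennreal_plus ennreal_mult)
    then have "r \<le> 2 * k" using r real by (subst (asm) ennreal_le_iff) auto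
    then have "ennreal r \<le> ennreal (2 * k)" by (rule ennreal_leI)
    also have "\<dots> = 2 * ennreal k" using real by (simp add: ennreal_mult)
    finally show ?thesis using r real by simp
  qed simp
  ultimately have "f \<le> 2 * K" by blast
  then show ?thesis by (simp add: f_def K_def)
qed

section \<open>Removal of the boundedness assumption by truncation\<close>

lemma SUP_min_of_nat: "(SUP n. min x (of_nat n)) = (x :: ennreal)"
proof -
  have "(SUP n. min x (of_nat n)) = inf x (SUP n. of_nat n)"
    unfolding inf_SUP by (simp add: inf_min)
  then show ?thesis by (simp add: ennreal_SUP_of_nat_eq_top)
qed

text \<open>Monotone convergence is applied twice, first over paths at a fixed time and then over
  time.\<close>

lemma occupation_SUP:
  assumes [measurable]: "\<And>n. Q n \<in> borel_measurable borel" and "incseq Q"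
  shows "occupation T (\<lambda>y. SUP n. Q n y) x = (SUP n. occupation T (Q n) x)"
proof -
  have trans: "transition u (\<lambda>y. SUP n. Q n y) x = (SUP n. transition u (Q n) x)" if "0 \<le> u" for u
  proof -
    have [measurable]: "X u \<in> borel_measurable M" using that by (rule rv)
    show ?thesis
      unfolding transition_def using assms(2)
      by (intro nn_integral_monotone_convergence_SUP) (auto simp: incseq_def le_fun_def)
  qed
  have mono: "incseq (\<lambda>n. transition u (Q n) x)" for u
    unfolding transition_def using assms(2)
    by (intro incseq_SucI nn_integral_mono) (auto simp: incseq_def le_fun_def)
  have "occupation T (\<lambda>y. SUP n. Q n y) x
      = (\<integral>\<^sup>+u. (SUP n. transition (max 0 u) (Q n) x * indicator {0..T} u) \<partial>lborel)"
    unfolding occupation_alt by (simp add: trans SUP_mult_right_ennreal)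
  also have "\<dots> = (SUP n. occupation T (Q n) x)"
    unfolding occupation_alt
  proof (rule nn_integral_monotone_convergence_SUP)
    show "incseq (\<lambda>n u. transition (max 0 u) (Q n) x * indicator {0..T} u)"
      using mono by (auto simp: incseq_def le_fun_def intro: mult_right_mono)
    show "(\<lambda>u. transition (max 0 u) (Q n) x * indicator {0..T} u) \<in> borel_measurable lborel" for n
      using measurable_compose[of "\<lambda>u. (u, x)" borel, OF _ transition_measurable[OF assms(1)[of n]]] by simp
  qed
  finally show ?thesis .
qed

text \<open>The factor 2 for the truncations \<open>min (Q y) (of_nat n)\<close> does not depend on
  their bound \<open>n\<close>, so the estimate survives the supremum over \<open>n\<close>.\<close>

lemma occupation_le_local:
  assumes [measurable]: "Q \<in> borel_measurable borel"
    and "0 < a" "0 < T"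
    and "\<And>n. prob {\<omega> \<in> space M. \<exists>j\<le>Suc n. a \<le> norm (X (real j * T / real (Suc n)) \<omega>)} \<le> 1 / 2"
  shows "occupation T Q x \<le> 2 * (SUP x. occupation T (\<lambda>y. indicator (ball x (2 * a)) y * Q y) x)"
proof -
  define q where "q n y = min (Q y) (of_nat n)" for n y
  have "occupation T Q x = occupation T (\<lambda>y. SUP n. q n y) x"
    by (simp add: q_def SUP_min_of_nat)
  also have "\<dots> = (SUP n. occupation T (q n) x)"
    by (rule occupation_SUP) (auto simp: q_def incseq_def le_fun_def min_le_iff_disj intro: min.mono)
  also have "\<dots> \<le> 2 * (SUP x. occupation T (\<lambda>y. indicator (ball x (2 * a)) y * Q y) x)"
  proof (rule SUP_least)
    fix n
    have "occupation T (q n) x \<le> (SUP x. occupation T (q n) x)" by (rule SUP_upper) simp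
    also have "\<dots> \<le> 2 * (SUP x. occupation T (\<lambda>y. indicator (ball x (2 * a)) y * q n y) x)"
      by (rule occupation_le_bounded[where c = "real n"]) (use assms in \<open>simp_all add: q_def[abs_def] flip: ennreal_of_nat_eq_real_of_nat\<close>)
    also have "\<dots> \<le> 2 * (SUP x. occupation T (\<lambda>y. indicator (ball x (2 * a)) y * Q y) x)"
      by (intro mult_left_mono SUP_mono') (auto intro!: occupation_mono mult_left_mono simp: q_def)
    finally show "occupation T (q n) x \<le> \<dots>" .
  qed
  finally show ?thesis .
qed

end

section \<open>The equivalence of the two limits\<close>

theorem theorem1p3:
  fixes M :: "'a measure"
    and X :: "real \<Rightarrow> 'a \<Rightarrow> real ^ 'd"
    and q :: "real ^ 'd \<Rightarrow> real"
  assumes "levy_process M X"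
    and "q \<in> borel_measurable borel"
  shows "((\<lambda>t. SUP x. expectation_from M X x
            (\<lambda>Y. \<integral>\<^sup>+u\<in>{0..t}. ennreal \<bar>q (Y u)\<bar> \<partial>lborel)) \<longlongrightarrow> 0) (at_right 0)
     \<longleftrightarrow> ((\<lambda>r. SUP x. expectation_from M X x
            (\<lambda>Y. \<integral>\<^sup>+u\<in>{0..r}. indicator (ball x r) (Y u) * ennreal \<bar>q (Y u)\<bar> \<partial>lborel)) \<longlongrightarrow> 0) (at_right 0)"
proof -
  interpret levy_process M X by fact
  note assms(2)[measurable]
  let ?Q = "\<lambda>y. ennreal \<bar>q y\<bar>"
  define f where "f t = (SUP x. occupation t ?Q x)" for t
  define K where "K r = (SUP x. occupation r (\<lambda>y. indicator (ball x r) y * ?Q y) x)" for r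
  have [measurable]: "(\<lambda>y. indicator (ball x r) y * ?Q y) \<in> borel_measurable borel" for x r
    by (intro borel_measurable_times_ennreal borel_measurable_indicator) simp_all
  have f: "expectation_from M X x (\<lambda>Y. \<integral>\<^sup>+u\<in>{0..t}. ennreal \<bar>q (Y u)\<bar> \<partial>lborel) = occupation t ?Q x" for t x
    unfolding occupation_def by (rule expectation_from_time_integral) auto
  have K: "expectation_from M X x (\<lambda>Y. \<integral>\<^sup>+u\<in>{0..r}. indicator (ball x r) (Y u) * ennreal \<bar>q (Y u)\<bar> \<partial>lborel)
      = occupation r (\<lambda>y. indicator (ball x r) y * ?Q y) x" for r x
    unfolding occupation_def by (rule expectation_from_time_integral) auto
  have f_mono: "f t \<le> f t'" if "t \<le> t'" for t t'
    unfolding f_def using that by (intro SUP_mono') (auto intro: occupation_mono)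
  have K_le_f: "K r \<le> f r" for r
    unfolding f_def K_def
    by (intro SUP_mono') (auto intro!: occupation_mono split: split_indicator)
  have "(f \<longlongrightarrow> 0) (at_right 0) \<longleftrightarrow> (K \<longlongrightarrow> 0) (at_right 0)"
  proof
    assume "(f \<longlongrightarrow> 0) (at_right 0)"
    then show "(K \<longlongrightarrow> 0) (at_right 0)"
      by (rule tendsto_sandwich[OF _ _ tendsto_const, rotated 2]) (auto simp: K_le_f)
  next
    assume K0: "(K \<longlongrightarrow> 0) (at_right 0)"
    show "(f \<longlongrightarrow> 0) (at_right 0)"
    proof (rule order_tendstoI)
      fix e :: ennreal assume "0 < e"
      \<comment> \<open>Half of \<open>e\<close> compensates the factor 2 in
        \<open>occupation_le_local\<close>.\<close>
      define e' where "e' = e / 2"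
      have e': "0 < e'" "2 * e' \<le> e"
        using \<open>0 < e\<close> by (simp_all add: e'_def ennreal_zero_less_divide ennreal_times_divide mult.commute[of 2] ennreal_mult_divide_eq)
      have "\<forall>\<^sub>F r in at_right 0. K r < e'" using K0 e'(1) by (rule order_tendstoD)
      then obtain b where b: "0 < b" "\<And>r. 0 < r \<Longrightarrow> r < b \<Longrightarrow> K r < e'"
        unfolding eventually_at_right_field by auto
      define r where "r = b / 2"
      have r: "0 < r" "K r < e'" using b by (auto simp: r_def)
      \<comment> \<open>Passage radius \<open>r / 2\<close> leads to balls of radius exactly
        \<open>r\<close>, and \<open>T \<le> r\<close> allows the time window to be enlarged to the
        one in \<open>K r\<close>.\<close>
      obtain T where T: "0 < T" "T \<le> r"
        "\<And>n. prob {\<omega> \<in> space M. \<exists>j\<le>Suc n. r / 2 \<le> norm (X (real j * T / real (Suc n)) \<omega>)} \<le> 1 / 2"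
        by (rule prob_grid_passage_small[of "r / 2" r]) (use r in auto)
      have "f T \<le> 2 * (SUP x. occupation T (\<lambda>y. indicator (ball x (2 * (r / 2))) y * ?Q y) x)"
        unfolding f_def by (intro SUP_least occupation_le_local T) (use r in auto)
      also have "\<dots> \<le> 2 * K r"
        unfolding K_def using T(2) by (intro mult_left_mono SUP_mono') (auto intro: occupation_mono)
      also have "\<dots> < 2 * e'"
        using r by (intro ennreal_mult_strict_left_mono) auto
      finally have "f T < e" using e'(2) by simp
      then have "f t < e" if "t < T" for t
        using f_mono[of t T] that by auto
      then show "\<forall>\<^sub>F t in at_right 0. f t < e"
        using T(1) by (auto simp: eventually_at_right_field)
    qed auto
  qed
  then show ?thesis by (simp only: f K f_def[abs_def] K_def[abs_def])
qed

end
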